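(* Let $\mathbf{A}\in\mathbb{C}^{N\times N}$ be non-singular and diagonalizable, let $\mathbf{b}\in\mathbb{C}^N$, and let $\mathbf{r}_n$ denote the GMRES residual at iteration $n$ for $\mathbf{A}\mathbf{x}=\mathbf{b}$. Let $l,m$ be integers with $0<l<l+m<N$. Let $J\in[1,l]$, and consider a set $N_J^{(l)}$ of $J$ harmonic Ritz values at iteration $l$, along with a set $\Lambda_J$ of $J$ eigenvalues of $\mathbf{A}$. Let $\Gamma_J$ (resp. $\Gamma_J^c$) be a Jordan curve enclosing the eigenvalues in $\Lambda_J$ (resp. $\Lambda_J^c:=\sigma(\mathbf{A})\setminus\Lambda_J$) of $\mathbf{A}$ and no other eigenvalues. Suppose there exists a constant $\varepsilon_J^c>0$ such that $$\left\|(\mathbf{A}-z\mathbf{I})^{-1}\right\|_2\le\frac{1}{\varepsilon_J^c}\qquad\text{for all } z\in\Gamma_J^c.$$ Then, for iteration indices $l$ and $l+m$, the residuals satisfy $$\frac{\|\mathbf{r}_{l+m}\|_2}{\|\mathbf{r}_l\|_2}\;\le\;\frac{\mathcal{L}(\Gamma_J^c)}{2\pi\,\varepsilon_J^c}\;\max_{z\in\Gamma_J^c}|s_J^l(z)|\;\min_{q_m\in\mathcal{P}_m^1}\;\max_{z\in\Gamma_J^c}|q_m(z)|,$$ where $\mathcal{L}(\Gamma_J^c)$ denotes the length of the contour $\Gamma_J^c$ and $$s_J^l(z):=\frac{\prod_{\lambda_j\in\Lambda_J}\left(1-\frac{z}{\lambda_j}\right)}{\prod_{\nu_j^{(l)}\in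 N_J^{(l)}}\left(1-\frac{z}{\nu_j^{(l)}}\right)}.$$
   Context: $\sigma(\mathbf{A})$ is the set of eigenvalues of $\mathbf{A}$. $\mathcal{P}_n^1$ is the set of polynomials $q$ of degree at most $n$ with $q(0)=1$. $\|\cdot\|_2$ is the Euclidean norm for vectors and the induced spectral norm for matrices. GMRES: given an initial guess $\mathbf{x}_0$ and $\mathbf{r}_0=\mathbf{b}-\mathbf{A}\mathbf{x}_0$, the iterate $\mathbf{x}_n$ minimizes $\|\mathbf{b}-\mathbf{A}\mathbf{x}\|_2$ over $\mathbf{x}\in\mathbf{x}_0+\mathrm{span}\{\mathbf{r}_0,\mathbf{A}\mathbf{r}_0,\dots,\mathbf{A}^{n-1}\mathbf{r}_0\}$, and $\mathbf{r}_n=\mathbf{b}-\mathbf{A}\mathbf{x}_n$. Equivalently $\|\mathbf{r}_n\|_2=\min_{q\in\mathcal{P}_n^1}\|q(\mathbf{A})\mathbf{r}_0\|_2$; $p_n\in\mathcal{P}_n^1$ denotes the polynomial achieving this minimum, so $\mathbf{r}_n=p_n(\mathbf{A})\mathbf{r}_0$. Harmonic Ritz values at iteration $l$: the roots $\nu_1^{(l)},\dots,\nu_l^{(l)}$ of $p_l$. They are non-zero since $p_l(0)=1$, and $p_l(z)=\prod_{j=1}^l(1-z/\nu_j^{(l)})$.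
   Formalization: The formal theorem additionally assumes that the selected harmonic Ritz values in N_J^(l) lie strictly outside the curve Γ_J^c; without this the stated bound is false. The curve Γ_J^c is also taken to have finite length. *)

theory Defs
  imports "HOL-Analysis.Analysis" "HOL-Computational_Algebra.Polynomial"
begin

section \<open>Matrices\<close>

definition spectrum :: "complex^'n^'n \<Rightarrow> complex set" where
  "spectrum A = {\<mu>. \<exists>v. v \<noteq> 0 \<and> A *v v = \<mu> *s v}"

definition diagonalizable :: "complex^'n^'n \<Rightarrow> bool" where
  "diagonalizable A \<longleftrightarrow>
     (\<exists>(P :: complex^'n^'n) (D :: complex^'n^'n).
        invertible P \<and> (\<forall>i j. i \<noteq> j \<longrightarrow> D $ i $ j = 0) \<and> A = P ** D ** matrix_inv P)"

text \<open>The norm of \<^typ>\<open>complex^'n\<close> is the Euclidean norm, so this is the induced 2-norm.\<close>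

definition spectral_norm :: "complex^'n^'n \<Rightarrow> real" where
  "spectral_norm A = onorm ((*v) A)"

text \<open>The power operation that the library provides on \<^typ>\<open>complex^'n^'n\<close> is entrywise,
  hence a separate notion of matrix power.\<close>

primrec mat_power :: "complex^'n^'n \<Rightarrow> nat \<Rightarrow> complex^'n^'n" where
  "mat_power A 0 = mat 1"
| "mat_power A (Suc k) = A ** mat_power A k"

definition poly_mat :: "complex poly \<Rightarrow> complex^'n^'n \<Rightarrow> complex^'n^'n" where
  "poly_mat q A = (\<Sum>i\<le>degree q. mat (coeff q i) ** mat_power A i)"


section \<open>GMRES\<close>

text \<open>\<^const>\<open>vec.span\<close> is the span over the scalar field, here the complex numbers;
  \<^const>\<open>span\<close> would be the real span.\<close>

definition krylov :: "complex^'n^'n \<Rightarrow> complex^'n \<Rightarrow> nat \<Rightarrow> (complex^'n) set" where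
  "krylov A r n = vec.span {mat_power A k *v r | k. k < n}"

definition residual :: "complex^'n^'n \<Rightarrow> complex^'n \<Rightarrow> complex^'n \<Rightarrow> complex^'n" where
  "residual A b x = b - A *v x"

definition gmres_iterate ::
  "complex^'n^'n \<Rightarrow> complex^'n \<Rightarrow> complex^'n \<Rightarrow> nat \<Rightarrow> complex^'n \<Rightarrow> bool" where
  "gmres_iterate A b x0 n x \<longleftrightarrow>
     x - x0 \<in> krylov A (residual A b x0) n \<and>
     (\<forall>y. y - x0 \<in> krylov A (residual A b x0) n \<longrightarrow>
        norm (residual A b x) \<le> norm (residual A b y))"

definition polys_one_at_0 :: "nat \<Rightarrow> complex poly set" where
  "polys_one_at_0 n = {q. degree q \<le> n \<and> poly q 0 = 1}"

definition gmres_poly :: "complex^'n^'n \<Rightarrow> complex^'n \<Rightarrow> nat \<Rightarrow> complex poly \<Rightarrow> bool" where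
  "gmres_poly A r0 n p \<longleftrightarrow>
     p \<in> polys_one_at_0 n \<and>
     (\<forall>q \<in> polys_one_at_0 n. norm (poly_mat p A *v r0) \<le> norm (poly_mat q A *v r0))"

text \<open>The harmonic Ritz values at iteration \<open>l\<close> are the roots, with multiplicity, of the GMRES
  polynomial \<open>p\<close> at iteration \<open>l\<close>, i.e. the multiset \<^term>\<open>proots p\<close>; a selection of them is a
  sub-multiset \<open>N\<close>. The eigenvalues in \<open>\<Lambda>\<close> are distinct.
  At a pole the quotient below has the HOL value \<open>0\<close>; the theorem keeps the elements of \<open>N\<close>
  strictly outside the curve on which \<open>s_fun\<close> is maximised, so that \<open>s_fun\<close> is analytic on and
  inside it. Without that the bound fails: take \<open>A = diag(1, 2, 3, 10^6)\<close>, initial residual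
  \<open>(1, 1, 1, 0)\<close>, \<open>l = m = 1\<close>, \<open>\<Lambda> = {10^6}\<close>, and the circle \<open>|z| = 1000\<close> around
  the remaining eigenvalues, which also encloses the harmonic Ritz value \<open>7/3\<close>.\<close>

definition s_fun :: "complex set \<Rightarrow> complex multiset \<Rightarrow> complex \<Rightarrow> complex" where
  "s_fun \<Lambda> N z = (\<Prod>\<mu>\<in>\<Lambda>. 1 - z / \<mu>) / (\<Prod>\<nu>\<in>#N. 1 - z / \<nu>)"


section \<open>Jordan curves\<close>

definition jordan_curve :: "(real \<Rightarrow> complex) \<Rightarrow> bool" where
  "jordan_curve \<gamma> \<longleftrightarrow> simple_path \<gamma> \<and> pathfinish \<gamma> = pathstart \<gamma>"

text \<open>Among the points of \<open>S\<close>, the curve encloses those in \<open>T\<close> and no others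
  (and passes through none of them).\<close>

definition encloses_exactly :: "(real \<Rightarrow> complex) \<Rightarrow> complex set \<Rightarrow> complex set \<Rightarrow> bool" where
  "encloses_exactly \<gamma> S T \<longleftrightarrow>
     T \<subseteq> inside (path_image \<gamma>) \<and> S - T \<subseteq> outside (path_image \<gamma>)"

definition inscribed_lengths :: "(real \<Rightarrow> complex) \<Rightarrow> real set" where
  "inscribed_lengths \<gamma> =
     {\<Sum>i<n. dist (\<gamma> (t i)) (\<gamma> (t (Suc i))) | (n :: nat) (t :: nat \<Rightarrow> real).
        mono t \<and> range t \<subseteq> {0..1}}"

definition rectifiable :: "(real \<Rightarrow> complex) \<Rightarrow> bool" where
  "rectifiable \<gamma> \<longleftrightarrow> bdd_above (inscribed_lengths \<gamma>)"

definition curve_length :: "(real \<Rightarrow> complex) \<Rightarrow> real" where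
  "curve_length \<gamma> = Sup (inscribed_lengths \<gamma>)"

end

theory Submission
  imports Defs "HOL-Complex_Analysis.Complex_Analysis"
    "HOL-Computational_Algebra.Fundamental_Theorem_Algebra"
begin

text \<open>Replacing in the GMRES polynomial \<open>p\<close> the factors \<open>1 - z / \<nu>\<close>, \<open>\<nu> \<in> N\<^sub>J\<close>, by the factors
  \<open>1 - z / \<mu>\<close>, \<open>\<mu> \<in> \<Lambda>\<^sub>J\<close>, gives \<open>p s\<close>, again a polynomial of degree at most \<open>l\<close> with value 1 at 0.
  For each \<open>q\<close> the residual at step \<open>l + m\<close> is therefore at most the norm of
  \<open>w = (p s)(A) q(A) r\<^sub>0\<close>. As \<open>s\<close> vanishes on \<open>\<Lambda>\<^sub>J\<close>, only eigenvectors for the other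
  eigenvalues contribute to \<open>w\<close>, and Cauchy's formula gives
  \<open>2 \<pi> \<i> w = \<plusminus> \<integral> s(z) q(z) (z - A)\<inverse> p(A) r\<^sub>0 dz\<close> over \<open>\<Gamma>\<^sub>c\<close>. The integral is evaluated after
  pairing with \<open>w\<close> itself, which keeps it scalar, and \<open>\<Gamma>\<^sub>c\<close>, which is only
  rectifiable, is replaced by inscribed polygons, which are no longer than \<open>\<Gamma>\<^sub>c\<close>.\<close>

section \<open>Contour integrals along rectifiable loops\<close>

text \<open>The polygon with nodes \<open>\<gamma> (i / n)\<close>, each edge traversed in time
  \<open>1 / n\<close>. The clamped coefficient is 0 before edge \<open>i\<close> begins and 1 once
  it is done, so the polygon is a finite sum of ramps rather than an iterated join of paths.\<close>

definition inscribed_polygon :: "(real \<Rightarrow> 'a::real_normed_vector) \<Rightarrow> nat \<Rightarrow> real \<Rightarrow> 'a" where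
  "inscribed_polygon \<gamma> n t =
     \<gamma> 0 + (\<Sum>i<n. max 0 (min 1 (n * t - i)) *\<^sub>R (\<gamma> (Suc i / n) - \<gamma> (i / n)))"

text \<open>At such a time the edges before \<open>k\<close> have been traversed completely and
  telescope to \<open>\<gamma> (k / n) - \<gamma> 0\<close>, while later edges still contribute
  nothing.\<close>

lemma inscribed_polygon_eq_linepath:
  assumes k: "k < n" and t: "k / n \<le> t" "t \<le> Suc k / n"
  shows "inscribed_polygon \<gamma> n t = linepath (\<gamma> (k / n)) (\<gamma> (Suc k / n)) (n * t - k)"
proof -
  have n: "real n > 0" using k by simp
  have s: "real k \<le> n * t" "n * t \<le> real k + 1"
    using t n by (simp_all add: field_simps)
  define f where "f = (\<lambda>i. max 0 (min 1 (n * t - i)) *\<^sub>R (\<gamma> (Suc i / n) - \<gamma> (i / n)))"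
  have "(\<Sum>i<n. f i) = (\<Sum>i<k. f i) + f k + (\<Sum>i\<in>{Suc k..<n}. f i)"
    using k by (simp add: lessThan_atLeast0 flip: sum.lessThan_Suc[of f k])
      (metis Suc_leI sum.atLeastLessThan_concat lessThan_Suc_atMost sum.lessThan_Suc lessThan_atLeast0 zero_le)
  also have "(\<Sum>i\<in>{Suc k..<n}. f i) = 0"
    using s by (intro sum.neutral) (auto simp: f_def)
  also have "(\<Sum>i<k. f i) = (\<Sum>i<k. \<gamma> (Suc i / n) - \<gamma> (i / n))"
    using s by (intro sum.cong) (auto simp: f_def)
  also have "\<dots> = \<gamma> (k / n) - \<gamma> 0"
    using sum_lessThan_telescope[of "\<lambda>i. \<gamma> (real i / n)" k] by simp
  also have "f k = (n * t - k) *\<^sub>R (\<gamma> (Suc k / n) - \<gamma> (k / n))"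
    using s by (simp add: f_def)
  finally show ?thesis
    unfolding inscribed_polygon_def f_def linepath_def by (simp add: algebra_simps)
qed

text \<open>Each summand is constant, then linear, then constant again, and piecewise continuous
  differentiability passes to finite sums.\<close>

lemma valid_path_inscribed_polygon: "valid_path (inscribed_polygon \<gamma> n)"
proof -
  have *: "(\<lambda>t::real. max 0 (min 1 (n * t - i)) *\<^sub>R (d::'a)) piecewise_C1_differentiable_on {0..1}"
    if "i < n" for i :: nat and d
  proof -
    have n: "real n > 0" using that by simp
    have "(\<lambda>t::real. if t \<le> Suc i / n then (n * t - i) *\<^sub>R d else d)
      piecewise_C1_differentiable_on {i / n..1}"
    proof (rule piecewise_C1_differentiable_cases)
      show "(\<lambda>t. (real n * t - real i) *\<^sub>R d) piecewise_C1_differentiable_on {i / n..Suc i / n}"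
        by (auto intro!: C1_differentiable_imp_piecewise derivative_intros)
      show "(real n * (real (Suc i) / n) - i) *\<^sub>R d = d"
        using n by simp
    qed (use that in \<open>auto intro!: C1_differentiable_imp_piecewise simp: divide_right_mono\<close>)
    then have "(\<lambda>t::real. if t \<le> i / n then 0 else if t \<le> Suc i / n then (n * t - i) *\<^sub>R d else d)
      piecewise_C1_differentiable_on {0..1}"
      using n that
      by (intro piecewise_C1_differentiable_cases)
        (auto intro!: C1_differentiable_imp_piecewise simp: divide_right_mono)
    also have "(\<lambda>t::real. if t \<le> i / n then 0 else if t \<le> Suc i / n then (n * t - i) *\<^sub>R d else d)
        = (\<lambda>t::real. max 0 (min 1 (n * t - i)) *\<^sub>R d)"
    proof
      fix t :: real
      have "t \<le> i / n \<longleftrightarrow> n * t - i \<le> 0" "t \<le> Suc i / n \<longleftrightarrow> n * t - i \<le> 1"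
        using n by (simp_all add: field_simps)
      then show "(if t \<le> i / n then 0 else if t \<le> Suc i / n then (n * t - i) *\<^sub>R d else d)
          = max 0 (min 1 (n * t - i)) *\<^sub>R d"
        by (simp add: max_def min.commute[of 1] min_def)
    qed
    finally show ?thesis .
  qed
  have "(\<lambda>t::real. c + (\<Sum>i<k. max 0 (min 1 (n * t - i)) *\<^sub>R (d i :: 'a))) piecewise_C1_differentiable_on {0..1}"
    if "k \<le> n" for k :: nat and c d
    using that
  proof (induction k)
    case 0
    show ?case by (simp add: C1_differentiable_imp_piecewise)
  next
    case (Suc k)
    then show ?case
      using piecewise_C1_differentiable_add[OF _ *[of k "d k"], of "\<lambda>t::real. c + (\<Sum>i<k. max 0 (min 1 (n * t - i)) *\<^sub>R (d i :: 'a))"]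
      by (simp add: add.assoc)
  qed
  from this[of n] show ?thesis
    unfolding valid_path_def inscribed_polygon_def[abs_def] by simp
qed

lemma unit_interval_subdivision:
  fixes n :: nat and t :: real
  assumes "n > 0" "t \<in> {0..1}"
  obtains k :: nat where "k < n" "k / n \<le> t" "t \<le> Suc k / n"
proof (cases "t = 1")
  case True
  \<comment> \<open>The floor of \<open>n * t\<close> would give \<open>n\<close> here; the last
    interval is taken instead.\<close>
  then show ?thesis using assms that[of "n - 1"] by simp
next
  case False
  define k where "k = nat \<lfloor>n * t\<rfloor>"
  have "real k \<le> n * t" "n * t < real k + 1"
    using assms by (simp_all add: k_def)
  moreover have "n * t < n" using False assms by simp
  moreover from calculation have "real k < real n" by linarith
  ultimately show ?thesis
    using assms by (intro that[of k]) (auto simp: field_simps)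
qed

lemma inscribed_polygon_node:
  fixes k n :: nat
  assumes "k \<le> n" "n > 0"
  shows "inscribed_polygon \<gamma> n (k / n) = \<gamma> (k / n)"
proof (cases k)
  case 0
  then show ?thesis
    using assms inscribed_polygon_eq_linepath[of 0 n 0 \<gamma>] by (simp add: linepath_def)
next
  \<comment> \<open>The node is read as the end of edge \<open>j\<close>, since no edge starts at
    the last node.\<close>
  case (Suc j)
  then show ?thesis
    using assms inscribed_polygon_eq_linepath[of j n "k / n" \<gamma>] by (simp add: linepath_def divide_simps)
qed

lemma polygon_length_le_curve_length:
  assumes "rectifiable \<gamma>"
  shows "(\<Sum>i<n. dist (\<gamma> (i / n)) (\<gamma> (Suc i / n))) \<le> curve_length \<gamma>"
proof (cases "n = 0")
  case True
  \<comment> \<open>The empty sum is itself an inscribed length; this case later shows that the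
    length is nonnegative.\<close>
  have "0 \<in> inscribed_lengths \<gamma>"
    unfolding inscribed_lengths_def
    by (rule CollectI, rule exI[of _ 0], rule exI[of _ "\<lambda>_. 0"]) (auto simp: mono_def)
  then show ?thesis
    using assms True unfolding rectifiable_def curve_length_def by (auto intro: cSup_upper)
next
  case False
  \<comment> \<open>\<open>inscribed_lengths\<close> asks for an infinite monotone sequence in the
    unit interval, so the nodes are continued by the constant 1.\<close>
  define t where "t i = min 1 (real i / n)" for i
  have "t i = real i / n" if "i \<le> n" for i
    using that False by (simp add: t_def min_def divide_simps)
  then have "(\<Sum>i<n. dist (\<gamma> (i / n)) (\<gamma> (Suc i / n))) = (\<Sum>i<n. dist (\<gamma> (t i)) (\<gamma> (t (Suc i))))"
    by (intro sum.cong) auto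
  moreover have "mono t"
    using False by (auto simp: t_def mono_def divide_right_mono min.coboundedI2)
  moreover have "range t \<subseteq> {0..1}"
    by (auto simp: t_def)
  ultimately have "(\<Sum>i<n. dist (\<gamma> (i / n)) (\<gamma> (Suc i / n))) \<in> inscribed_lengths \<gamma>"
    unfolding inscribed_lengths_def by blast
  then show ?thesis
    using assms unfolding rectifiable_def curve_length_def by (rule cSup_upper)
qed

section \<open>Estimates of contour integrals along inscribed polygons\<close>

text \<open>A contour integral sees a path only on the unit interval, because the derivative is
  taken within \<open>{0..1}\<close>. This allows an edge, given as a subpath, to be exchanged for a
  \<open>linepath\<close>.\<close>

lemma contour_integral_cong_path:
  assumes "\<And>t. t \<in> {0..1} \<Longrightarrow> g t = h t"
  shows "contour_integral g f = contour_integral h f"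
proof -
  have "(g has_vector_derivative d) (at t within {0..1}) \<longleftrightarrow>
      (h has_vector_derivative d) (at t within {0..1})" if "t \<in> {0..1}" for t d
    using assms that by (metis has_vector_derivative_transform)
  then have "vector_derivative g (at t within {0..1}) = vector_derivative h (at t within {0..1})"
    if "t \<in> {0..1}" for t
    using that by (simp add: vector_derivative_def)
  then have "(f has_contour_integral i) g \<longleftrightarrow> (f has_contour_integral i) h" for i
    using assms unfolding has_contour_integral_def by (intro has_integral_cong) (simp only:)
  then show ?thesis
    unfolding contour_integral_def contour_integrable_on_def by simp
qed

text \<open>Maximum times length on each edge, summed by induction over the initial portion of the
  polygon up to time \<open>k / n\<close>.\<close>

lemma contour_integral_inscribed_polygon_bound:
  fixes \<gamma> :: "real \<Rightarrow> complex"
  assumes n: "n > 0" and "0 \<le> M"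
    and f: "continuous_on (path_image (inscribed_polygon \<gamma> n)) f"
    and M: "\<And>z. z \<in> path_image (inscribed_polygon \<gamma> n) \<Longrightarrow> cmod (f z) \<le> M"
    and int: "f contour_integrable_on inscribed_polygon \<gamma> n"
  shows "cmod (contour_integral (inscribed_polygon \<gamma> n) f)
    \<le> M * (\<Sum>i<n. dist (\<gamma> (i / n)) (\<gamma> (Suc i / n)))"
proof -
  let ?p = "inscribed_polygon \<gamma> n"
  have seg: "subpath (k / n) (Suc k / n) ?p t = linepath (\<gamma> (k / n)) (\<gamma> (Suc k / n)) t"
    if "k < n" "t \<in> {0..1}" for k t
  proof -
    have e: "(real (Suc k) / n - k / n) * t + k / n = (k + t) / n"
      using n by (simp add: field_simps)
    show ?thesis
      unfolding subpath_def e
      using inscribed_polygon_eq_linepath[of k n "(k + t) / n" \<gamma>] that n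
      by (simp add: divide_right_mono)
  qed
  have "cmod (contour_integral (subpath 0 (k / n) ?p) f)
    \<le> M * (\<Sum>i<k. dist (\<gamma> (i / n)) (\<gamma> (Suc i / n)))" if "k \<le> n" for k
    using that
  proof (induction k)
    case (Suc k)
    then have k: "k < n" by simp
    let ?l = "linepath (\<gamma> (k / n)) (\<gamma> (Suc k / n))"
    have u: "real k / n \<in> {0..1}" "real (Suc k) / n \<in> {0..1}"
      using k by auto
    have img: "closed_segment (\<gamma> (k / n)) (\<gamma> (Suc k / n)) \<subseteq> path_image ?p"
    proof -
      have "path_image ?l = path_image (subpath (k / n) (Suc k / n) ?p)"
        unfolding path_image_def using seg[OF k] by (intro image_cong) auto
      also have "\<dots> \<subseteq> path_image ?p"
        using u by (intro path_image_subpath_subset) auto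
      finally show ?thesis by simp
    qed
    have "contour_integral (subpath 0 (Suc k / n) ?p) f =
      contour_integral (subpath 0 (k / n) ?p) f + contour_integral (subpath (k / n) (Suc k / n) ?p) f"
      using u by (intro contour_integral_subpath_combine[symmetric] int valid_path_inscribed_polygon) auto
    also have "contour_integral (subpath (k / n) (Suc k / n) ?p) f = contour_integral ?l f"
      using seg[OF k] by (rule contour_integral_cong_path)
    also have "cmod (contour_integral (subpath 0 (k / n) ?p) f + contour_integral ?l f) \<le>
       M * (\<Sum>i<k. dist (\<gamma> (i / n)) (\<gamma> (Suc i / n))) + M * cmod (\<gamma> (Suc k / n) - \<gamma> (k / n))"
      using Suc.IH k img \<open>0 \<le> M\<close>
      by (intro norm_triangle_mono contour_integral_bound_linepath M
          contour_integrable_continuous_linepath continuous_on_subset[OF f img]) auto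
    finally show ?case
      by (simp add: dist_norm norm_minus_commute algebra_simps)
  qed (use \<open>0 \<le> M\<close> in simp)
  from this[of n] n show ?thesis by simp
qed

section \<open>Polygons close to a rectifiable loop\<close>

text \<open>Both ends of the edge reached at time \<open>t\<close> lie in the ball of radius
  \<open>e\<close> around \<open>\<gamma> t\<close>, and by convexity so does the edge.\<close>

lemma dist_inscribed_polygon_less:
  assumes \<gamma>: "\<And>s t. s \<in> {0..1} \<Longrightarrow> t \<in> {0..1} \<Longrightarrow> dist s t < r \<Longrightarrow> dist (\<gamma> s) (\<gamma> t) < e"
    and n: "n > 0" "1 / n < r" and t: "t \<in> {0..1}"
  shows "dist (\<gamma> t) (inscribed_polygon \<gamma> n t) < e"
proof -
  obtain k :: nat where k: "k < n" "k / n \<le> t" "t \<le> Suc k / n"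
    using unit_interval_subdivision[OF n(1) t] .
  have "real (Suc k) / n - k / n = 1 / n"
    by (simp add: diff_divide_distrib[symmetric])
  then have "dist t (k / n) < r" "dist t (Suc k / n) < r"
    using k n by (auto simp: dist_real_def)
  then have "\<gamma> (k / n) \<in> ball (\<gamma> t) e" "\<gamma> (Suc k / n) \<in> ball (\<gamma> t) e"
    using k t by (auto intro!: \<gamma>)
  then have "closed_segment (\<gamma> (k / n)) (\<gamma> (Suc k / n)) \<subseteq> ball (\<gamma> t) e"
    by (intro closed_segment_subset convex_ball)
  moreover have "inscribed_polygon \<gamma> n t \<in> closed_segment (\<gamma> (k / n)) (\<gamma> (Suc k / n))"
    unfolding inscribed_polygon_eq_linepath[OF k]
    using k by (intro linepath_in_path) (auto simp: field_simps)
  ultimately show ?thesis by auto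
qed

text \<open>A fine inscribed polygon is so close to \<open>\<gamma>\<close> that the linear homotopy
  between them avoids \<open>K\<close>, which preserves winding numbers, and that uniform continuity
  of \<open>f\<close> near the curve costs at most \<open>\<delta>\<close> in the bound.\<close>

lemma rectifiable_loop_polygon_approx:
  assumes \<gamma>: "path \<gamma>" "pathfinish \<gamma> = pathstart \<gamma>" "rectifiable \<gamma>"
    and K: "closed K" "path_image \<gamma> \<inter> K = {}"
    and f: "f holomorphic_on -K"
    and B: "\<And>z. z \<in> path_image \<gamma> \<Longrightarrow> cmod (f z) \<le> B"
    and \<delta>: "\<delta> > 0"
  obtains \<eta> where "valid_path \<eta>" "pathfinish \<eta> = pathstart \<eta>" "path_image \<eta> \<inter> K = {}"
    "\<And>z. z \<in> K \<Longrightarrow> winding_number \<eta> z = winding_number \<gamma> z"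
    "cmod (contour_integral \<eta> f) \<le> (B + \<delta>) * curve_length \<gamma>"
proof -
  have cpt: "compact (path_image \<gamma>)"
    using \<gamma>(1) by (rule compact_path_image)
  obtain d where d: "d > 0" "\<And>x y. x \<in> path_image \<gamma> \<Longrightarrow> y \<in> K \<Longrightarrow> d \<le> dist x y"
    using separate_compact_closed[OF cpt K] by blast
  \<comment> \<open>A compact neighbourhood of the curve disjoint from \<open>K\<close>; it will
    contain the polygon, and \<open>f\<close> is uniformly continuous on it.\<close>
  define C where "C = {x + y | x y. x \<in> path_image \<gamma> \<and> y \<in> cball 0 (d / 2)}"
  have "compact C"
    unfolding C_def by (rule compact_sums[OF cpt compact_cball])
  moreover have "C \<subseteq> -K"
  proof -
    have "x + y \<notin> K" if "x \<in> path_image \<gamma>" "norm y \<le> d / 2" for x y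
      using d(2)[OF that(1), of "x + y"] that(2) d(1) by (auto simp: dist_norm)
    then show ?thesis by (auto simp: C_def)
  qed
  then have "continuous_on C f"
    using f holomorphic_on_imp_continuous_on continuous_on_subset by blast
  ultimately have "uniformly_continuous_on C f"
    by (intro compact_uniformly_continuous)
  then obtain e1 where e1: "e1 > 0" "\<And>z w. z \<in> C \<Longrightarrow> w \<in> C \<Longrightarrow> dist w z < e1 \<Longrightarrow> dist (f w) (f z) < \<delta>"
    using \<delta> unfolding uniformly_continuous_on_def by metis
  \<comment> \<open>The bound \<open>d / 2\<close> keeps the polygon inside \<open>C\<close>, the
    bound \<open>e1\<close> keeps the values of \<open>f\<close> within
    \<open>\<delta>\<close>.\<close>
  define e where "e = min (d / 2) e1"
  have e: "e > 0" "e \<le> d / 2" "e \<le> e1"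
    using d e1 by (auto simp: e_def)
  have "uniformly_continuous_on {0..1} \<gamma>"
    using \<gamma>(1) unfolding path_def by (intro compact_uniformly_continuous) auto
  then obtain r where r: "r > 0"
    "\<And>s t. s \<in> {0..1} \<Longrightarrow> t \<in> {0..1} \<Longrightarrow> dist s t < r \<Longrightarrow> dist (\<gamma> s) (\<gamma> t) < e"
    using e(1) unfolding uniformly_continuous_on_def by metis
  obtain n :: nat where n: "n > 0" "1 / n < r"
    using r(1) by (metis nat_approx_posE of_nat_Suc zero_less_Suc)
  define \<eta> where "\<eta> = inscribed_polygon \<gamma> n"
  have near: "dist (\<gamma> t) (\<eta> t) < e" if "t \<in> {0..1}" for t
    unfolding \<eta>_def using r(2) n that by (rule dist_inscribed_polygon_less)
  have valid: "valid_path \<eta>"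
    unfolding \<eta>_def by (rule valid_path_inscribed_polygon)
  have loop: "pathfinish \<eta> = pathstart \<eta>"
    using inscribed_polygon_node[of 0 n \<gamma>] inscribed_polygon_node[of n n \<gamma>] n \<gamma>(2)
    by (simp add: \<eta>_def pathfinish_def pathstart_def)
  \<comment> \<open>A point of \<open>K\<close> on this segment would be closer to the curve than
    \<open>d\<close>.\<close>
  have seg: "z \<notin> closed_segment (\<gamma> t) (\<eta> t)" if "t \<in> {0..1}" "z \<in> K" for t z
  proof
    assume "z \<in> closed_segment (\<gamma> t) (\<eta> t)"
    then have "dist (\<gamma> t) z \<le> dist (\<gamma> t) (\<eta> t)"
      by (metis segment_bound(1) dist_norm norm_minus_commute)
    moreover have "d \<le> dist (\<gamma> t) z"
      using that by (intro d(2)) (auto simp: path_image_def)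
    ultimately show False
      using near[OF that(1)] e(2) d(1) by linarith
  qed
  have disj: "path_image \<eta> \<inter> K = {}"
    using seg by (fastforce simp: path_image_def)
  have wind: "winding_number \<eta> z = winding_number \<gamma> z" if "z \<in> K" for z
    using \<gamma> valid loop seg that
    by (intro winding_number_loops_linear_eq) (auto simp: valid_path_imp_path)
  have bound: "cmod (f z) \<le> B + \<delta>" if z: "z \<in> path_image \<eta>" for z
  proof -
    obtain t where t: "t \<in> {0..1}" "z = \<eta> t"
      using z unfolding path_image_def by blast
    have \<gamma>t: "\<gamma> t \<in> path_image \<gamma>"
      using t by (auto simp: path_image_def)
    have "\<eta> t = \<gamma> t + (\<eta> t - \<gamma> t)" "\<gamma> t = \<gamma> t + 0" by simp_all
    moreover have "\<eta> t - \<gamma> t \<in> cball 0 (d / 2)" "0 \<in> cball (0::complex) (d / 2)"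
      using near[OF t(1)] e d by (auto simp: dist_norm norm_minus_commute)
    ultimately have "\<eta> t \<in> C" "\<gamma> t \<in> C"
      unfolding C_def using \<gamma>t by blast+
    then have "dist (f (\<gamma> t)) (f (\<eta> t)) < \<delta>"
      using near[OF t(1)] e(3) by (intro e1(2)) auto
    then show ?thesis
      using B[OF \<gamma>t] norm_triangle_ineq2[of "f (\<eta> t)" "f (\<gamma> t)"] t(2)
      by (simp add: dist_norm norm_minus_commute)
  qed
  have B\<delta>: "0 \<le> B + \<delta>"
    using order_trans[OF norm_ge_zero bound[of "\<eta> 0"]] by (auto simp: path_image_def)
  have "cmod (contour_integral \<eta> f) \<le> (B + \<delta>) * (\<Sum>i<n. dist (\<gamma> (i / n)) (\<gamma> (Suc i / n)))"
    unfolding \<eta>_def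
  proof (rule contour_integral_inscribed_polygon_bound[OF n(1) B\<delta>])
    show "continuous_on (path_image (inscribed_polygon \<gamma> n)) f"
      using f disj holomorphic_on_imp_continuous_on continuous_on_subset unfolding \<eta>_def by blast
    show "f contour_integrable_on inscribed_polygon \<gamma> n"
      using f K(1) disj valid unfolding \<eta>_def
      by (intro contour_integrable_holomorphic_simple[of f "-K"]) (auto simp: open_Compl)
  qed (use bound \<eta>_def in auto)
  also have "\<dots> \<le> (B + \<delta>) * curve_length \<gamma>"
    using B\<delta> \<gamma>(3) by (intro mult_left_mono polygon_length_le_curve_length)
  finally show ?thesis
    using that valid loop disj wind by blast
qed

lemma curve_length_nonneg: "rectifiable \<gamma> \<Longrightarrow> 0 \<le> curve_length \<gamma>"
  using polygon_length_le_curve_length[of \<gamma> 0] by simp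

text \<open>Contour integrals need piecewise differentiable paths, so the integral over the merely
  rectifiable \<open>\<gamma>\<close> is represented by its common value \<open>I\<close> on the differentiable loops that wind
  around the singularities like \<open>\<gamma>\<close>.\<close>

lemma rectifiable_loop_integral_bound:
  assumes \<gamma>: "path \<gamma>" "pathfinish \<gamma> = pathstart \<gamma>" "rectifiable \<gamma>"
    and K: "closed K" "path_image \<gamma> \<inter> K = {}"
    and f: "f holomorphic_on -K"
    and B: "\<And>z. z \<in> path_image \<gamma> \<Longrightarrow> cmod (f z) \<le> B"
    and I: "\<And>\<eta>. valid_path \<eta> \<Longrightarrow> pathfinish \<eta> = pathstart \<eta> \<Longrightarrow> path_image \<eta> \<inter> K = {} \<Longrightarrow>
      (\<And>z. z \<in> K \<Longrightarrow> winding_number \<eta> z = winding_number \<gamma> z) \<Longrightarrow> contour_integral \<eta> f = I"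
  shows "cmod I \<le> B * curve_length \<gamma>"
proof (rule field_le_epsilon)
  fix e :: real assume "e > 0"
  define L where "L = curve_length \<gamma>"
  have L: "L \<ge> 0" unfolding L_def by (rule curve_length_nonneg[OF \<gamma>(3)])
  \<comment> \<open>Adding 1 to the denominator covers a length of 0 and still gives
    \<open>\<delta> * L \<le> e\<close>.\<close>
  define \<delta> where "\<delta> = e / (L + 1)"
  have \<delta>: "\<delta> > 0" using \<open>e > 0\<close> L by (simp add: \<delta>_def)
  obtain \<eta> where "valid_path \<eta>" "pathfinish \<eta> = pathstart \<eta>" "path_image \<eta> \<inter> K = {}"
    "\<And>z. z \<in> K \<Longrightarrow> winding_number \<eta> z = winding_number \<gamma> z"
    "cmod (contour_integral \<eta> f) \<le> (B + \<delta>) * L"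
    using rectifiable_loop_polygon_approx[OF \<gamma> K f B \<delta>] unfolding L_def by blast
  then have "cmod I \<le> (B + \<delta>) * L"
    using I by metis
  also have "\<delta> * L \<le> e"
    using \<open>e > 0\<close> L by (simp add: \<delta>_def field_simps)
  then have "(B + \<delta>) * L \<le> B * L + e"
    by (simp add: algebra_simps)
  finally show "cmod I \<le> B * curve_length \<gamma> + e"
    by (simp add: L_def)
qed

section \<open>GMRES residuals and polynomials\<close>

lemma mat_mult_vec: "mat c *v (v :: 'a::semiring_1^'n) = c *s v"
  by (simp add: vec_eq_iff matrix_vector_mult_def mat_def if_distrib[of "\<lambda>x. x * _"] cong: if_cong)

lemma sum_mult_vec: "(\<Sum>i\<in>I. M i) *v (v :: 'a::semiring_1^'n) = (\<Sum>i\<in>I. M i *v v)"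
  by (induction I rule: infinite_finite_induct) (auto simp: matrix_vector_mult_add_rdistrib)

lemma mult_vec_sum: "M *v (\<Sum>i\<in>I. v i :: 'a::semiring_1^'n) = (\<Sum>i\<in>I. M *v v i)"
  by (induction I rule: infinite_finite_induct) (auto simp: matrix_vector_right_distrib)

lemma mult_vec_axis: "M *v axis j (1 :: 'a::semiring_1) = column j M"
  by (simp add: vec_eq_iff matrix_vector_mult_def axis_def column_def if_distrib[of "\<lambda>x. _ * x"] cong: if_cong)

text \<open>The upper limit may exceed the degree, so that polynomials of different degrees can be
  combined term by term.\<close>

lemma poly_mat_mult_vec:
  assumes "degree q \<le> n"
  shows "poly_mat q A *v r = (\<Sum>i\<le>n. coeff q i *s (mat_power A i *v r))"
proof -
  have "poly_mat q A *v r = (\<Sum>i\<le>degree q. coeff q i *s (mat_power A i *v r))"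
    by (simp add: poly_mat_def sum_mult_vec mat_mult_vec flip: matrix_vector_mul_assoc)
  also have "\<dots> = (\<Sum>i\<le>n. coeff q i *s (mat_power A i *v r))"
    using assms by (intro sum.mono_neutral_left) (auto simp: coeff_eq_0)
  finally show ?thesis .
qed

lemma poly_mat_add_vec: "poly_mat (p + q) A *v r = poly_mat p A *v r + poly_mat q A *v r"
  using degree_add_le_max[of p q]
  by (simp add: poly_mat_mult_vec[where n = "max (degree p) (degree q)"]
      vector_sadd_rdistrib sum.distrib)

lemma poly_mat_smult_vec: "poly_mat (smult c q) A *v r = c *s (poly_mat q A *v r)"
  by (simp add: poly_mat_mult_vec[where n = "degree q"] degree_smult_le vec.scale_sum_right)

lemma poly_mat_eigenvector:
  assumes "A *v v = \<mu> *s v"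
  shows "poly_mat q A *v v = poly q \<mu> *s v"
proof -
  have "mat_power A i *v v = \<mu> ^ i *s v" for i
    by (induction i) (simp_all add: assms vector_scalar_commute mult.commute flip: matrix_vector_mul_assoc)
  then show ?thesis
    by (simp add: poly_mat_mult_vec[OF order.refl] poly_altdef vec.scale_sum_left)
qed

section \<open>Krylov spaces and residual polynomials\<close>

text \<open>The vectors with this property form a complex subspace. It contains each generator
  \<open>mat_power A k *v r\<close>, via the monomial of degree \<open>k + 1\<close>, and hence the
  whole Krylov space.\<close>

lemma krylov_image:
  assumes "v \<in> krylov A r n"
  shows "\<exists>q. degree q \<le> n \<and> poly q 0 = 0 \<and> A *v v = poly_mat q A *v r"
proof -
  let ?W = "{v. \<exists>q. degree q \<le> n \<and> poly q 0 = 0 \<and> A *v v = poly_mat q A *v r}"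
  have "vec.subspace ?W"
    unfolding vec.subspace_def
  proof (intro conjI ballI allI)
    show "0 \<in> ?W"
      by (auto intro!: exI[of _ 0] simp: poly_mat_mult_vec[of 0 0])
    show "x + y \<in> ?W" if "x \<in> ?W" "y \<in> ?W" for x y
    proof -
      from that obtain p q where "degree p \<le> n" "poly p 0 = 0" "A *v x = poly_mat p A *v r"
        "degree q \<le> n" "poly q 0 = 0" "A *v y = poly_mat q A *v r" by auto
      then show ?thesis
        by (auto intro!: exI[of _ "p + q"] degree_add_le
            simp: poly_mat_add_vec matrix_vector_right_distrib)
    qed
    show "c *s x \<in> ?W" if "x \<in> ?W" for c x
    proof -
      from that obtain p where "degree p \<le> n" "poly p 0 = 0" "A *v x = poly_mat p A *v r" by auto
      then show ?thesis
        by (auto intro!: exI[of _ "smult c p"] order_trans[OF degree_smult_le]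
            simp: poly_mat_smult_vec vector_scalar_commute)
    qed
  qed
  moreover have "{mat_power A k *v r | k. k < n} \<subseteq> ?W"
  proof clarify
    fix k assume "k < n"
    then show "\<exists>q. degree q \<le> n \<and> poly q 0 = 0 \<and> A *v (mat_power A k *v r) = poly_mat q A *v r"
      by (intro exI[of _ "monom 1 (Suc k)"])
        (auto simp: degree_monom_eq poly_monom poly_mat_mult_vec[OF degree_monom_le]
          matrix_vector_mul_assoc if_distrib[of "\<lambda>c. c *s _"] cong: if_cong)
  qed
  ultimately show ?thesis
    using assms vec.span_minimal unfolding krylov_def by blast
qed

lemma residual_shift: "residual A b y = residual A b x0 - A *v (y - x0)"
  by (simp add: residual_def matrix_vector_mult_diff_distrib)

text \<open>Subtracting the polynomial of \<open>krylov_image\<close> from 1 describes the residual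
  of any candidate in the affine Krylov space.\<close>

lemma residual_eq_poly_mat:
  assumes "y - x0 \<in> krylov A (residual A b x0) n"
  obtains q where "q \<in> polys_one_at_0 n" "residual A b y = poly_mat q A *v residual A b x0"
proof -
  let ?r = "residual A b x0"
  obtain q where q: "degree q \<le> n" "poly q 0 = 0" "A *v (y - x0) = poly_mat q A *v ?r"
    using krylov_image[OF assms] by blast
  have "poly_mat (1 + smult (-1) q) A *v ?r = ?r - A *v (y - x0)"
    by (simp add: poly_mat_add_vec poly_mat_smult_vec q(3) poly_mat_mult_vec[of 1 0]
        del: smult_minus_left)
  moreover have "1 + smult (-1) q \<in> polys_one_at_0 n"
    using q by (auto simp: polys_one_at_0_def intro!: degree_diff_le)
  ultimately show ?thesis
    using that residual_shift by metis
qed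

lemma poly_mat_eq_residual:
  assumes "q \<in> polys_one_at_0 n"
  obtains y where "y - x0 \<in> krylov A (residual A b x0) n"
    "residual A b y = poly_mat q A *v residual A b x0"
proof -
  let ?r = "residual A b x0"
  \<comment> \<open>This is \<open>(q - 1) / z\<close>, evaluated at \<open>A\<close> and applied to
    the initial residual, so \<open>A *v v\<close> supplies all terms of \<open>q\<close> but the
    constant one.\<close>
  define v where "v = (\<Sum>i<n. coeff q (Suc i) *s (mat_power A i *v ?r))"
  have "v \<in> krylov A ?r n"
    unfolding v_def krylov_def by (intro vec.span_sum vec.span_scale vec.span_base) auto
  then have "(x0 - v) - x0 \<in> krylov A ?r n"
    using vec.span_neg unfolding krylov_def by fastforce
  moreover have "residual A b (x0 - v) = poly_mat q A *v ?r"
  proof -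
    have "poly_mat q A *v ?r = (\<Sum>i\<le>n. coeff q i *s (mat_power A i *v ?r))"
      using assms by (intro poly_mat_mult_vec) (simp add: polys_one_at_0_def)
    also have "\<dots> = ?r + A *v v"
      using assms
      by (simp add: v_def mult_vec_sum vector_scalar_commute sum.atMost_shift polys_one_at_0_def
          poly_0_coeff_0 matrix_vector_mul_assoc)
    finally show ?thesis
      using residual_shift[of A b "x0 - v" x0] matrix_vector_mult_diff_distrib[of A 0 v] by simp
  qed
  ultimately show ?thesis by (rule that)
qed

lemma gmres_iterate_le_poly_mat:
  assumes "gmres_iterate A b x0 n x" "q \<in> polys_one_at_0 n"
  shows "norm (residual A b x) \<le> norm (poly_mat q A *v residual A b x0)"
  using poly_mat_eq_residual[OF assms(2), of x0 A b] assms(1)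
  unfolding gmres_iterate_def by metis

text \<open>The residual of the iterate comes from an admissible polynomial, so \<open>p\<close>
  cannot do worse. This turns a bound in terms of \<open>p\<close> into one in terms of the
  residual.\<close>

lemma gmres_poly_le_iterate:
  assumes "gmres_iterate A b x0 n x" "gmres_poly A (residual A b x0) n p"
  shows "norm (poly_mat p A *v residual A b x0) \<le> norm (residual A b x)"
  using residual_eq_poly_mat[of x x0 A b n] assms
  unfolding gmres_iterate_def gmres_poly_def by metis

section \<open>Eigenvector expansions and resolvents\<close>

lemma invertible_mult_matrix_inv:
  assumes "invertible A"
  shows "A ** matrix_inv A = mat 1" "matrix_inv A ** A = mat 1"
  using someI_ex[of "\<lambda>B. A ** B = mat 1 \<and> B ** A = mat 1"] assms
  unfolding invertible_def matrix_inv_def by auto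

text \<open>The columns of \<open>P\<close> serve as eigenvectors and
  \<open>matrix_inv P *v r\<close> as coefficients. The index type \<open>'n\<close> lists
  eigenvalues with multiplicity.\<close>

lemma diagonalizable_eigenbasis:
  fixes A :: "complex^'n^'n"
  assumes "diagonalizable A"
  obtains v :: "'n \<Rightarrow> complex^'n" and d :: "'n \<Rightarrow> complex" where
    "\<And>j. A *v v j = d j *s v j" "\<And>j. d j \<in> spectrum A"
    "\<And>r. \<exists>c. r = (\<Sum>j\<in>UNIV. c j *s v j)"
proof -
  obtain P D :: "complex^'n^'n" where P: "invertible P" and D: "\<And>i j. i \<noteq> j \<Longrightarrow> D $ i $ j = 0"
    and A: "A = P ** D ** matrix_inv P"
    using assms unfolding diagonalizable_def by blast
  define v where "v j = P *v axis j 1" for j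
  define d where "d j = D $ j $ j" for j
  have "D *v axis j 1 = d j *s axis j 1" for j
    unfolding mult_vec_axis using D by (auto simp: vec_eq_iff column_def axis_def d_def)
  moreover have "A *v v j = P *v (D *v (matrix_inv P ** P *v axis j 1))" for j
    by (simp add: A v_def matrix_vector_mul_assoc matrix_mul_assoc)
  ultimately have eig: "A *v v j = d j *s v j" for j
    by (simp add: invertible_mult_matrix_inv[OF P] vector_scalar_commute v_def)
  have "v j \<noteq> 0" for j
  proof
    assume "v j = 0"
    then have "matrix_inv P *v v j = 0" by simp
    then have "axis j (1::complex) = 0"
      by (simp add: v_def matrix_vector_mul_assoc invertible_mult_matrix_inv[OF P])
    then show False by (simp add: axis_eq_0_iff)
  qed
  then have "d j \<in> spectrum A" for j
    using eig unfolding spectrum_def by blast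
  moreover have "\<exists>c. r = (\<Sum>j\<in>UNIV. c j *s v j)" for r
  proof -
    have "r = P *v (matrix_inv P *v r)"
      by (simp add: matrix_vector_mul_assoc invertible_mult_matrix_inv[OF P])
    also have "\<dots> = (\<Sum>j\<in>UNIV. (matrix_inv P *v r) $ j *s v j)"
      by (subst matrix_mult_sum) (simp add: v_def mult_vec_axis)
    finally show ?thesis by blast
  qed
  ultimately show ?thesis using that eig by blast
qed

lemma zero_notin_spectrum:
  assumes "invertible A"
  shows "0 \<notin> spectrum A"
  using assms unfolding invertible_left_inverse matrix_left_invertible_ker by (auto simp: spectrum_def)

text \<open>\<open>matrix_inv\<close> is a choice and has its meaning only once invertibility is
  known; here that holds as \<open>z\<close> is no eigenvalue. A solution of the shifted system then
  identifies the resolvent.\<close>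

lemma matrix_inv_shift_mult_vec:
  assumes "z \<notin> spectrum A" "A *v u - z *s u = r"
  shows "matrix_inv (A - mat z) *v r = u"
proof -
  have "invertible (A - mat z)"
    using assms(1) unfolding invertible_left_inverse matrix_left_invertible_ker spectrum_def
    by (auto simp: matrix_vector_mult_diff_rdistrib mat_mult_vec)
  moreover have "r = (A - mat z) *v u"
    using assms(2) by (simp add: matrix_vector_mult_diff_rdistrib mat_mult_vec)
  ultimately show ?thesis
    by (simp add: matrix_vector_mul_assoc invertible_mult_matrix_inv)
qed

lemma norm_mult_vec_le_spectral_norm: "norm (M *v r) \<le> spectral_norm M * norm r"
  unfolding spectral_norm_def by (rule onorm) simp

text \<open>Complex-linear in the first argument, as needed to pull out complex coefficients;
  \<open>inner\<close> on this type is its real part.\<close>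

definition hermitian_dot :: "complex^'n \<Rightarrow> complex^'n \<Rightarrow> complex" where
  "hermitian_dot u w = (\<Sum>i\<in>UNIV. u $ i * cnj (w $ i))"

lemma hermitian_dot_combination:
  "hermitian_dot (\<Sum>j\<in>I. c j *s v j) w = (\<Sum>j\<in>I. c j * hermitian_dot (v j) w)"
  unfolding hermitian_dot_def
  by (simp add: sum_distrib_left sum_distrib_right mult.assoc) (rule sum.swap)

lemma hermitian_dot_self: "hermitian_dot w w = of_real ((norm w)\<^sup>2)"
  by (simp add: hermitian_dot_def norm_vec_def L2_set_def sum_nonneg flip: complex_norm_square)

lemma norm_hermitian_dot_le: "cmod (hermitian_dot u w) \<le> norm u * norm w"
proof -
  have "cmod (hermitian_dot u w) \<le> (\<Sum>i\<in>UNIV. \<bar>cmod (u $ i)\<bar> * \<bar>cmod (w $ i)\<bar>)"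
    unfolding hermitian_dot_def by (rule order_trans[OF norm_sum]) (simp add: norm_mult)
  also have "\<dots> \<le> norm u * norm w"
    unfolding norm_vec_def by (rule L2_set_mult_ineq)
  finally show ?thesis .
qed

section \<open>The residual bound\<close>

text \<open>Up to the constant \<open>- \<nu>\<close> the factor \<open>1 - z / \<nu>\<close> is
  \<open>z - \<nu>\<close>, and the product of the latter over all roots divides \<open>p\<close>.
  The cofactor \<open>R\<close> carries the roots that are not selected.\<close>

lemma poly_factor_harmonic_ritz:
  fixes p :: "complex poly"
  assumes "N \<subseteq># proots p" "poly p 0 \<noteq> 0"
  obtains R where "p = (\<Prod>\<nu>\<in>#N. [:1, - 1 / \<nu>:]) * R" "degree p = size N + degree R"
proof -
  have p: "p \<noteq> 0" using assms(2) by auto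
  \<comment> \<open>A zero in \<open>N\<close> would make its factor the constant 1, as
    \<open>1 / 0 = 0\<close>, and spoil the degree count.\<close>
  have "0 \<notin># N"
    using mset_subset_eqD[OF assms(1)] p assms(2) by auto
  then have "(\<Prod>\<nu>\<in>#N. [:1, - 1 / \<nu>:]) dvd (\<Prod>\<nu>\<in>#N. [:- \<nu>, 1:]) \<and>
    degree (\<Prod>\<nu>\<in>#N. [:1, - 1 / \<nu>:]) = size N \<and> (\<Prod>\<nu>\<in>#N. [:1, - 1 / \<nu>:]) \<noteq> 0"
  proof (induction N)
    case (add \<nu> N)
    have "[:- \<nu>, 1:] = [:1, - 1 / \<nu>:] * [:- \<nu>:]"
      using add.prems by simp
    then have "[:1, - 1 / \<nu>:] dvd [:- \<nu>, 1:]" by (rule dvdI)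
    then have "(\<Prod>\<nu>\<in>#add_mset \<nu> N. [:1, - 1 / \<nu>:]) dvd (\<Prod>\<nu>\<in>#add_mset \<nu> N. [:- \<nu>, 1:])"
      using add by (simp only: prod_mset.add_mset image_mset_add_mset) (intro mult_dvd_mono, auto)
    moreover have "degree (\<Prod>\<nu>\<in>#add_mset \<nu> N. [:1, - 1 / \<nu>:]) = size (add_mset \<nu> N) \<and>
        (\<Prod>\<nu>\<in>#add_mset \<nu> N. [:1, - 1 / \<nu>:]) \<noteq> 0"
      using add by (simp add: degree_mult_eq del: mult_pCons_left)
    ultimately show ?case ..
  qed simp
  then have dvd: "(\<Prod>\<nu>\<in>#N. [:1, - 1 / \<nu>:]) dvd (\<Prod>\<nu>\<in>#N. [:- \<nu>, 1:])"
    and deg: "degree (\<Prod>\<nu>\<in>#N. [:1, - 1 / \<nu>:]) = size N" "(\<Prod>\<nu>\<in>#N. [:1, - 1 / \<nu>:]) \<noteq> 0"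
    by auto
  note dvd
  also have "(\<Prod>\<nu>\<in>#N. [:- \<nu>, 1:]) dvd (\<Prod>\<nu>\<in>#proots p. [:- \<nu>, 1:])"
    using assms(1) by (intro prod_mset_subset_imp_dvd image_mset_subseteq_mono)
  \<comment> \<open>Over the complex numbers \<open>p\<close> is its leading coefficient times the
    product over its roots.\<close>
  also have "\<dots> dvd p"
    by (subst (2) complex_poly_decompose_multiset[symmetric]) (rule dvd_smult, simp)
  finally obtain R where R: "p = (\<Prod>\<nu>\<in>#N. [:1, - 1 / \<nu>:]) * R" ..
  moreover from this have "degree p = size N + degree R"
    using deg p by (metis degree_mult_eq mult_zero_right)
  ultimately show ?thesis by (rule that)
qed

text \<open>Cauchy's formula in its global form for each pole \<open>d j\<close>: the loop does not
  wind around \<open>K\<close>, where \<open>s\<close> may be singular. The common winding number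
  \<open>k\<close> factors out.\<close>

lemma sum_Cauchy_integral_formula:
  assumes K: "closed K" and s: "s holomorphic_on -K"
    and I: "finite I" and d: "\<And>j. j \<in> I \<Longrightarrow> d j \<notin> K"
    and \<eta>: "valid_path \<eta>" "pathfinish \<eta> = pathstart \<eta>" "path_image \<eta> \<inter> (K \<union> d ` I) = {}"
    and wK: "\<And>z. z \<in> K \<Longrightarrow> winding_number \<eta> z = 0"
    and wd: "\<And>j. j \<in> I \<Longrightarrow> winding_number \<eta> (d j) = k"
  shows "((\<lambda>z. s z * (\<Sum>j\<in>I. a j / (z - d j))) has_contour_integral
    2 * pi * \<i> * k * (\<Sum>j\<in>I. s (d j) * a j)) \<eta>"
proof -
  have "((\<lambda>z. s z * a j / (z - d j)) has_contour_integral
      2 * pi * \<i> * winding_number \<eta> (d j) * (s (d j) * a j)) \<eta>" if j: "j \<in> I" for j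
  proof (rule Cauchy_integral_formula_global)
    show "(\<lambda>z. s z * a j) holomorphic_on -K"
      by (intro holomorphic_intros s)
  qed (use assms j in auto)
  then have "((\<lambda>z. \<Sum>j\<in>I. s z * a j / (z - d j)) has_contour_integral
      (\<Sum>j\<in>I. 2 * pi * \<i> * k * (s (d j) * a j))) \<eta>"
    using wd by (intro has_contour_integral_sum I) auto
  then show ?thesis
    by (simp add: sum_distrib_left mult.assoc)
qed

lemma s_fun_holomorphic_on:
  assumes "set_mset N \<inter> X = {}"
  shows "s_fun \<Lambda> N holomorphic_on X"
proof -
  have "s_fun \<Lambda> N = (\<lambda>z. poly (\<Prod>\<mu>\<in>\<Lambda>. [:1, - 1 / \<mu>:]) z / poly (\<Prod>\<nu>\<in>#N. [:1, - 1 / \<nu>:]) z)"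
    by (simp add: s_fun_def fun_eq_iff poly_prod poly_prod_mset image_mset.compositionality comp_def)
  moreover have "poly (\<Prod>\<nu>\<in>#N. [:1, - 1 / \<nu>:]) z \<noteq> 0" if "z \<in> X" for z
    using assms that by (auto simp: poly_prod_mset image_mset.compositionality comp_def prod_mset_zero_iff)
  ultimately show ?thesis
    by (auto intro!: holomorphic_intros)
qed

section \<open>The bound for a fixed polynomial \<open>q\<close>\<close>

text \<open>Let \<open>w\<close> be the vector on the left. Pairing its integral formula with
  \<open>w\<close> makes \<open>2 * pi * (norm w)^2\<close> the modulus of a scalar integral; the
  resolvent bound estimates the integrand with one factor \<open>norm w\<close>, which
  cancels.\<close>

lemma deflated_residual_bound:
  fixes A :: "complex^'n^'n"
  assumes "invertible A" "diagonalizable A"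
    and p: "p = (\<Prod>\<nu>\<in>#N. [:1, - 1 / \<nu>:]) * R"
    and N: "set_mset N \<subseteq> outside (path_image \<gamma>)"
    and \<Lambda>: "\<Lambda> \<subseteq> spectrum A" "finite \<Lambda>"
    and \<gamma>: "jordan_curve \<gamma>" "encloses_exactly \<gamma> (spectrum A) (spectrum A - \<Lambda>)" "rectifiable \<gamma>"
    and \<epsilon>: "\<epsilon> > 0" "\<And>z. z \<in> path_image \<gamma> \<Longrightarrow> spectral_norm (matrix_inv (A - mat z)) \<le> 1 / \<epsilon>"
    and S: "\<And>z. z \<in> path_image \<gamma> \<Longrightarrow> cmod (s_fun \<Lambda> N z) \<le> S"
    and Q: "\<And>z. z \<in> path_image \<gamma> \<Longrightarrow> cmod (poly q z) \<le> Q"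
  shows "norm (poly_mat (R * (\<Prod>\<mu>\<in>\<Lambda>. [:1, - 1 / \<mu>:]) * q) A *v r)
    \<le> curve_length \<gamma> / (2 * pi * \<epsilon>) * S * Q * norm (poly_mat p A *v r)" (is "norm ?w \<le> _")
proof (cases "?w = 0")
  case False
  have \<gamma>': "simple_path \<gamma>" "path \<gamma>" "pathfinish \<gamma> = pathstart \<gamma>"
    using \<gamma>(1) by (auto simp: jordan_curve_def simple_path_imp_path)
  have inside: "spectrum A - \<Lambda> \<subseteq> inside (path_image \<gamma>)" and outside: "\<Lambda> \<subseteq> outside (path_image \<gamma>)"
    using \<gamma>(2) \<Lambda>(1) unfolding encloses_exactly_def by blast+
  have off: "z \<notin> path_image \<gamma>" if "z \<in> spectrum A \<union> set_mset N" for z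
    using that inside outside N inside_no_overlap[of "path_image \<gamma>"] outside_no_overlap[of "path_image \<gamma>"]
    by blast
  have \<Lambda>0: "0 \<notin> \<Lambda>"
    using zero_notin_spectrum[OF assms(1)] \<Lambda>(1) by blast
  have N0: "(\<Prod>\<nu>\<in>#N. 1 - z / \<nu>) \<noteq> 0" if "z \<notin> set_mset N" for z
    using that by (auto simp: prod_mset_zero_iff)
  \<comment> \<open>The numerator of \<open>s_fun \<Lambda> N\<close>; hence \<open>R * T\<close>
    agrees with \<open>p\<close> times \<open>s_fun \<Lambda> N\<close> off
    \<open>N\<close>.\<close>
  define T where "T = (\<Prod>\<mu>\<in>\<Lambda>. [:1, - 1 / \<mu>:])"
  have T_poly: "poly T z = (\<Prod>\<mu>\<in>\<Lambda>. 1 - z / \<mu>)" for z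
    by (simp add: T_def poly_prod)
  have T_root: "poly T z = 0" if "z \<in> \<Lambda>" for z
    unfolding T_poly using that \<Lambda>(2) \<Lambda>0 by (intro prod_zero bexI[of _ z]) auto
  have p_poly: "poly p z = (\<Prod>\<nu>\<in>#N. 1 - z / \<nu>) * poly R z" for z
    by (simp add: p poly_prod_mset image_mset.compositionality comp_def)

  obtain v :: "'n \<Rightarrow> complex^'n" and d where v: "\<And>j. A *v v j = d j *s v j" and d: "\<And>j. d j \<in> spectrum A"
    and basis: "\<And>r. \<exists>c. r = (\<Sum>j\<in>UNIV. c j *s v j)"
    by (rule diagonalizable_eigenbasis[OF assms(2)], rule that)
  obtain c where c: "r = (\<Sum>j\<in>UNIV. c j *s v j)"
    using basis by blast
  have expand: "poly_mat q A *v r = (\<Sum>j\<in>UNIV. (poly q (d j) * c j) *s v j)" for q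
    by (simp add: c mult_vec_sum vector_scalar_commute poly_mat_eigenvector[OF v] mult.commute)

  \<comment> \<open>The eigenvectors that can survive, since \<open>T\<close> vanishes on
    \<open>\<Lambda>\<close>.\<close>
  define J where "J = {j. d j \<notin> \<Lambda>}"
  define s where "s z = s_fun \<Lambda> N z * poly q z" for z
  define e where "e j = poly p (d j) * c j" for j
  have J: "d j \<in> inside (path_image \<gamma>)" "d j \<notin> set_mset N" if "j \<in> J" for j
    using that inside d N inside_Int_outside[of "path_image \<gamma>"] unfolding J_def by blast+
  have w: "?w = (\<Sum>j\<in>J. (s (d j) * e j) *s v j)"
  proof -
    have "?w = (\<Sum>j\<in>J. (poly (R * T * q) (d j) * c j) *s v j)"
      unfolding expand T_def[symmetric]
      by (intro sum.mono_neutral_right) (auto simp: J_def T_root)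
    also have "\<dots> = (\<Sum>j\<in>J. (s (d j) * e j) *s v j)"
      using J(2)[THEN N0]
      by (intro sum.cong) (auto simp: s_def e_def s_fun_def p_poly T_poly)
    finally show ?thesis .
  qed

  \<comment> \<open>On the curve, \<open>f z\<close> will be \<open>- s z\<close> times the pairing
    of \<open>matrix_inv (A - mat z) *v (poly_mat p A *v r)\<close> with \<open>?w\<close>.\<close>
  define a where "a j = e j * hermitian_dot (v j) ?w" for j
  define f where "f z = s z * (\<Sum>j\<in>UNIV. a j / (z - d j))" for z
  \<comment> \<open>The singularities outside the curve: possible poles of \<open>s\<close>, and the
    eigenvalues whose terms must drop out of the integral.\<close>
  define K where "K = set_mset N \<union> \<Lambda>"
  \<comment> \<open>The orientation of the Jordan curve is not prescribed, so \<open>k\<close> is 1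
    or -1; only its modulus enters the bound.\<close>
  define k where "k = (if \<exists>z\<in>inside (path_image \<gamma>). winding_number \<gamma> z = 1 then 1 else - 1 :: complex)"
  have k: "winding_number \<gamma> z = k" if "z \<in> inside (path_image \<gamma>)" for z
    using simple_closed_path_winding_number_inside[OF \<gamma>'(1)] that unfolding k_def by (metis one_neq_neg_one)
  have "cmod k = 1" by (simp add: k_def)

  have K: "closed K" "K \<subseteq> outside (path_image \<gamma>)" "finite (K \<union> range d)"
    using \<Lambda>(2) N outside by (auto simp: K_def intro!: finite_imp_closed)
  have s_hol: "s holomorphic_on -K"
    unfolding s_def by (intro holomorphic_intros s_fun_holomorphic_on) (auto simp: K_def)
  have f_hol: "f holomorphic_on -(K \<union> range d)"
    unfolding f_def by (intro holomorphic_intros holomorphic_on_subset[OF s_hol]) auto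
  have disj: "path_image \<gamma> \<inter> (K \<union> range d) = {}"
    using off d \<Lambda>(1) by (auto simp: K_def)

  have ww: "(\<Sum>j\<in>J. s (d j) * a j) = of_real ((norm ?w)\<^sup>2)"
  proof -
    have "of_real ((norm ?w)\<^sup>2) = hermitian_dot (\<Sum>j\<in>J. (s (d j) * e j) *s v j) ?w"
      using hermitian_dot_self[of ?w] w by simp
    then show ?thesis
      by (simp add: hermitian_dot_combination a_def mult.assoc)
  qed

  have integral: "contour_integral \<eta> f = 2 * pi * \<i> * k * of_real ((norm ?w)\<^sup>2)"
    if \<eta>: "valid_path \<eta>" "pathfinish \<eta> = pathstart \<eta>" "path_image \<eta> \<inter> (K \<union> range d) = {}"
      and wn: "\<And>z. z \<in> K \<union> range d \<Longrightarrow> winding_number \<eta> z = winding_number \<gamma> z" for \<eta>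
  proof -
    have wK: "winding_number \<eta> z = 0" if "z \<in> K" for z
      using that wn K(2) \<gamma>' by (auto intro!: winding_number_zero_in_outside)
    have "((\<lambda>z. s z * (\<Sum>j\<in>J. a j / (z - d j))) has_contour_integral
        2 * pi * \<i> * k * (\<Sum>j\<in>J. s (d j) * a j)) \<eta>"
    proof (rule sum_Cauchy_integral_formula[OF K(1) s_hol])
      show "d j \<notin> K" if "j \<in> J" for j
        using J[OF that] that by (auto simp: K_def J_def)
      show "winding_number \<eta> (d j) = k" if "j \<in> J" for j
        using wn k J(1)[OF that] by simp
    qed (use \<eta> wK in auto)
    \<comment> \<open>The remaining poles lie in \<open>\<Lambda>\<close>, hence in
      \<open>K\<close>, around which \<open>\<eta>\<close> does not wind.\<close>
    moreover have "((\<lambda>z. s z * (\<Sum>j\<in>-J. a j / (z - d j))) has_contour_integral 0) \<eta>"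
    proof (rule Cauchy_theorem_global[of "-K"])
      show "(\<lambda>z. s z * (\<Sum>j\<in>-J. a j / (z - d j))) holomorphic_on -K"
        by (intro holomorphic_intros s_hol) (auto simp: J_def K_def)
    qed (use K(1) \<eta> wK in auto)
    ultimately have "((\<lambda>z. s z * (\<Sum>j\<in>J. a j / (z - d j)) + s z * (\<Sum>j\<in>-J. a j / (z - d j)))
        has_contour_integral 2 * pi * \<i> * k * (\<Sum>j\<in>J. s (d j) * a j) + 0) \<eta>"
      by (rule has_contour_integral_add)
    moreover have "s z * (\<Sum>j\<in>J. a j / (z - d j)) + s z * (\<Sum>j\<in>-J. a j / (z - d j)) = f z" for z
      unfolding f_def distrib_left[symmetric]
      by (subst sum.union_disjoint[symmetric]) (auto simp: Compl_partition)
    ultimately show ?thesis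
      by (simp add: ww contour_integral_unique)
  qed

  have bound: "cmod (f z) \<le> S * Q * (norm (poly_mat p A *v r) / \<epsilon> * norm ?w)"
    if z: "z \<in> path_image \<gamma>" for z
  proof -
    have dz: "d j \<noteq> z" for j
      using disj z by auto
    \<comment> \<open>The resolvent applied to \<open>poly_mat p A *v r\<close>, written in the
      eigenbasis.\<close>
    define u where "u = (\<Sum>j\<in>UNIV. (e j / (d j - z)) *s v j)"
    have "A *v u - z *s u = poly_mat p A *v r"
    proof -
      have cancel: "e j / (d j - z) * d j - z * (e j / (d j - z)) = e j" for j
      proof -
        have "e j / (d j - z) * d j - z * (e j / (d j - z)) = e j / (d j - z) * (d j - z)"
          by (simp only: right_diff_distrib mult.commute[of z])
        then show ?thesis using dz by simp
      qed
      have "A *v u - z *s u = (\<Sum>j\<in>UNIV. (e j / (d j - z) * d j - z * (e j / (d j - z))) *s v j)"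
        by (simp add: u_def mult_vec_sum vector_scalar_commute v vec.scale_sum_right
            vec.scale_left_diff_distrib sum_subtractf)
      also have "\<dots> = (\<Sum>j\<in>UNIV. e j *s v j)"
        by (simp only: cancel)
      finally show ?thesis
        by (simp add: expand e_def)
    qed
    then have "matrix_inv (A - mat z) *v (poly_mat p A *v r) = u"
      using off z by (intro matrix_inv_shift_mult_vec) auto
    then have "norm u \<le> spectral_norm (matrix_inv (A - mat z)) * norm (poly_mat p A *v r)"
      using norm_mult_vec_le_spectral_norm by metis
    also have "\<dots> \<le> 1 / \<epsilon> * norm (poly_mat p A *v r)"
      using \<epsilon>(2)[OF z] by (rule mult_right_mono) simp
    finally have u: "norm u \<le> norm (poly_mat p A *v r) / \<epsilon>" by simp
    have "a j / (z - d j) = - (e j / (d j - z) * hermitian_dot (v j) ?w)" for j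
    proof -
      have "z - d j = - (d j - z)" by simp
      then show ?thesis
        by (simp only: a_def divide_minus_right times_divide_eq_left)
    qed
    then have "(\<Sum>j\<in>UNIV. a j / (z - d j)) = - hermitian_dot u ?w"
      unfolding u_def hermitian_dot_combination by (simp only: sum_negf)
    then have "cmod (f z) = cmod (s_fun \<Lambda> N z) * cmod (poly q z) * cmod (hermitian_dot u ?w)"
      by (simp add: f_def s_def norm_mult)
    also have "\<dots> \<le> S * Q * (norm (poly_mat p A *v r) / \<epsilon> * norm ?w)"
      using S[OF z] Q[OF z] order_trans[OF norm_ge_zero S[OF z]] order_trans[OF norm_ge_zero Q[OF z]]
        order_trans[OF norm_hermitian_dot_le mult_right_mono[OF u norm_ge_zero]]
      by (intro mult_mono) auto
    finally show ?thesis .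
  qed

  have "cmod (2 * pi * \<i> * k * of_real ((norm ?w)\<^sup>2))
      \<le> S * Q * (norm (poly_mat p A *v r) / \<epsilon> * norm ?w) * curve_length \<gamma>"
    by (rule rectifiable_loop_integral_bound[OF \<gamma>'(2,3) \<gamma>(3) finite_imp_closed[OF K(3)] disj f_hol])
      (rule bound integral, assumption+)+
  also have "cmod (2 * pi * \<i> * k * of_real ((norm ?w)\<^sup>2)) = 2 * pi * norm ?w * norm ?w"
    using \<open>cmod k = 1\<close> by (simp add: norm_mult power2_eq_square)
  finally have "norm ?w * norm ?w \<le>
      curve_length \<gamma> / (2 * pi * \<epsilon>) * S * Q * norm (poly_mat p A *v r) * norm ?w"
    using \<epsilon>(1) by (simp add: field_simps)
  \<comment> \<open>One factor \<open>norm ?w\<close>, positive in this case, cancels.\<close>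
  then show ?thesis
    by (rule mult_right_le_imp_le) (simp only: zero_less_norm_iff False not_False_eq_True)
next
  case True
  \<comment> \<open>Only the sign of the right side is at stake; a point of the curve shows that
    \<open>S\<close> and \<open>Q\<close> are nonnegative.\<close>
  obtain z where z: "z \<in> path_image \<gamma>"
    using path_image_nonempty by blast
  have "0 \<le> S" "0 \<le> Q"
    using order_trans[OF norm_ge_zero S[OF z]] order_trans[OF norm_ge_zero Q[OF z]] by auto
  then show ?thesis
    unfolding True using curve_length_nonneg[OF \<gamma>(3)] \<epsilon>(1) by simp
qed

text \<open>By compactness of the curve; this makes the real suprema over it genuine upper
  bounds.\<close>

lemma bdd_above_cmod_path_image:
  assumes "path \<gamma>" "continuous_on (path_image \<gamma>) f"
  shows "bdd_above ((\<lambda>z. cmod (f z)) ` path_image \<gamma>)"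
  using assms
  by (intro bounded_imp_bdd_above compact_imp_bounded compact_continuous_image continuous_intros
      compact_path_image)

theorem theorem2p9:
  fixes A :: "complex^'n^'n"
    and b x0 :: "complex^'n"
    and x :: "nat \<Rightarrow> complex^'n"
    and l m J :: nat
    and p :: "complex poly"
    and N\<^sub>J :: "complex multiset"
    and \<Lambda>\<^sub>J :: "complex set"
    and \<Gamma> \<Gamma>\<^sub>c :: "real \<Rightarrow> complex"
    and \<epsilon> :: real
  assumes "invertible A" and "diagonalizable A"
    and "\<And>n. gmres_iterate A b x0 n (x n)"
    and "0 < l" and "l < l + m" and "l + m < CARD('n)"
    and "1 \<le> J" and "J \<le> l"
    and "gmres_poly A (residual A b x0) l p"
    and "N\<^sub>J \<subseteq># proots p" and "size N\<^sub>J = J"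
    and "\<Lambda>\<^sub>J \<subseteq> spectrum A" and "card \<Lambda>\<^sub>J = J"
    and "jordan_curve \<Gamma>" and "encloses_exactly \<Gamma> (spectrum A) \<Lambda>\<^sub>J"
    and "jordan_curve \<Gamma>\<^sub>c" and "encloses_exactly \<Gamma>\<^sub>c (spectrum A) (spectrum A - \<Lambda>\<^sub>J)"
    and "rectifiable \<Gamma>\<^sub>c"
    and "set_mset N\<^sub>J \<subseteq> outside (path_image \<Gamma>\<^sub>c)"
    and "\<epsilon> > 0"
    and "\<And>z. z \<in> path_image \<Gamma>\<^sub>c \<Longrightarrow> spectral_norm (matrix_inv (A - mat z)) \<le> 1 / \<epsilon>"
  shows "norm (residual A b (x (l + m))) / norm (residual A b (x l))
    \<le> curve_length \<Gamma>\<^sub>c / (2 * pi * \<epsilon>)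
      * (SUP z\<in>path_image \<Gamma>\<^sub>c. cmod (s_fun \<Lambda>\<^sub>J N\<^sub>J z))
      * (INF q\<in>polys_one_at_0 m. SUP z\<in>path_image \<Gamma>\<^sub>c. cmod (poly q z))"
proof -
  let ?r = "residual A b x0"
  let ?S = "SUP z\<in>path_image \<Gamma>\<^sub>c. cmod (s_fun \<Lambda>\<^sub>J N\<^sub>J z)"
  let ?Q = "\<lambda>q. SUP z\<in>path_image \<Gamma>\<^sub>c. cmod (poly q z)"
  define C where "C = curve_length \<Gamma>\<^sub>c / (2 * pi * \<epsilon>) * ?S"
  have path: "path \<Gamma>\<^sub>c"
    using assms(16) by (simp add: jordan_curve_def simple_path_imp_path)
  obtain z0 where z0: "z0 \<in> path_image \<Gamma>\<^sub>c"
    using path_image_nonempty by blast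
  have p: "degree p \<le> l" "poly p 0 = 1"
    using assms(9) by (auto simp: gmres_poly_def polys_one_at_0_def)
  obtain R where R: "p = (\<Prod>\<nu>\<in>#N\<^sub>J. [:1, - 1 / \<nu>:]) * R" "degree p = size N\<^sub>J + degree R"
    using poly_factor_harmonic_ritz[OF assms(10)] p(2) by auto
  \<comment> \<open>An infinite set has \<open>card\<close> 0, which \<open>1 \<le> J\<close>
    excludes.\<close>
  have \<Lambda>: "finite \<Lambda>\<^sub>J"
    using assms(7,13) card.infinite by fastforce
  have "continuous_on (path_image \<Gamma>\<^sub>c) (s_fun \<Lambda>\<^sub>J N\<^sub>J)"
    using assms(19) outside_no_overlap[of "path_image \<Gamma>\<^sub>c"]
    by (intro holomorphic_on_imp_continuous_on s_fun_holomorphic_on) blast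
  then have S: "cmod (s_fun \<Lambda>\<^sub>J N\<^sub>J z) \<le> ?S" if "z \<in> path_image \<Gamma>\<^sub>c" for z
    using that bdd_above_cmod_path_image[OF path] by (intro cSUP_upper)
  have Q: "cmod (poly q z) \<le> ?Q q" if "z \<in> path_image \<Gamma>\<^sub>c" for q z
    using that bdd_above_cmod_path_image[OF path, of "poly q"]
    by (intro cSUP_upper) (simp_all add: continuous_on_poly)
  have C: "C \<ge> 0"
    using order_trans[OF norm_ge_zero S[OF z0]] curve_length_nonneg[OF assms(18)] assms(20)
    by (simp add: C_def)
  have ratio: "norm (residual A b (x (l + m))) / norm (residual A b (x l)) \<le> C * ?Q q"
    if q: "q \<in> polys_one_at_0 m" for q
  proof -
    \<comment> \<open>The \<open>J\<close> selected factors of \<open>p\<close> are exchanged for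
      \<open>J\<close> eigenvalue factors, so the product before \<open>q\<close> still has degree
      at most \<open>l\<close>.\<close>
    let ?P = "R * (\<Prod>\<mu>\<in>\<Lambda>\<^sub>J. [:1, - 1 / \<mu>:]) * q"
    have "degree (\<Prod>\<mu>\<in>\<Lambda>\<^sub>J. [:1, - 1 / \<mu>:]) \<le> (\<Sum>\<mu>\<in>\<Lambda>\<^sub>J. degree [:1, - 1 / \<mu>:])"
      using degree_prod_sum_le[OF \<Lambda>, of "\<lambda>\<mu>. [:1, - 1 / \<mu>:]"] by (simp only: comp_def)
    also have "\<dots> \<le> (\<Sum>\<mu>\<in>\<Lambda>\<^sub>J. 1)"
      by (intro sum_mono) (simp split: if_splits)
    also have "\<dots> = J"
      using assms(13) by simp
    finally have "degree (\<Prod>\<mu>\<in>\<Lambda>\<^sub>J. [:1, - 1 / \<mu>:]) \<le> J" .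
    then have "degree ?P \<le> l + m"
      using q p(1) R(2) assms(11) degree_mult_le[of R "\<Prod>\<mu>\<in>\<Lambda>\<^sub>J. [:1, - 1 / \<mu>:]"]
        degree_mult_le[of "R * (\<Prod>\<mu>\<in>\<Lambda>\<^sub>J. [:1, - 1 / \<mu>:])" q]
      by (simp add: polys_one_at_0_def)
    moreover have "poly R 0 = 1"
      using p(2) by (simp add: R(1) poly_prod_mset image_mset.compositionality comp_def)
    then have "poly ?P 0 = 1"
      using q by (simp add: poly_prod polys_one_at_0_def)
    ultimately have "norm (residual A b (x (l + m))) \<le> norm (poly_mat ?P A *v ?r)"
      using assms(3) by (intro gmres_iterate_le_poly_mat) (auto simp: polys_one_at_0_def)
    also have "\<dots> \<le> C * ?Q q * norm (poly_mat p A *v ?r)"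
      unfolding C_def using assms \<Lambda> R(1) S Q by (intro deflated_residual_bound)
    also have "\<dots> \<le> C * ?Q q * norm (residual A b (x l))"
      using C order_trans[OF norm_ge_zero Q[OF z0]] assms(3,9)
      by (intro mult_left_mono gmres_poly_le_iterate) auto
    \<comment> \<open>If the residual at step \<open>l\<close> vanishes, the quotient is 0 by
      convention and nonnegativity of the right side suffices.\<close>
    finally show ?thesis
      using C order_trans[OF norm_ge_zero Q[OF z0, of q]]
      by (cases "residual A b (x l) = 0") (auto simp: field_simps)
  qed
  \<comment> \<open>The set under the infimum is thus nonempty.\<close>
  have "1 \<in> polys_one_at_0 m"
    by (simp add: polys_one_at_0_def)
  define \<rho> where "\<rho> = norm (residual A b (x (l + m))) / norm (residual A b (x l))"
  \<comment> \<open>Dividing by a positive \<open>C\<close> turns the bounds for all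
    \<open>q\<close> into a lower bound of the set; for \<open>C = 0\<close> the bound for
    \<open>q = 1\<close> already gives \<open>\<rho> \<le> 0\<close>.\<close>
  have "\<rho> \<le> C * (INF q\<in>polys_one_at_0 m. ?Q q)"
  proof (cases "C = 0")
    case True
    then show ?thesis
      using ratio[OF \<open>1 \<in> _\<close>] by (simp add: \<rho>_def)
  next
    case False
    then have "\<rho> / C \<le> (INF q\<in>polys_one_at_0 m. ?Q q)"
      using C ratio[folded \<rho>_def] \<open>1 \<in> _\<close>
      by (intro cINF_greatest) (auto simp: pos_divide_le_eq mult.commute)
    then show ?thesis
      using C False by (simp add: pos_divide_le_eq mult.commute)
  qed
  then show ?thesis
    unfolding \<rho>_def C_def .
qed

end
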